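(* Let $n,d,t$ be positive integers with $d<n$ and $t$ a multiple of $d$. If $$t \ge 2d\log_2\frac{en}{d} + \log_2 n,$$ then the $2t\times n$ random Boolean matrix $M$ constructed by sample-injection is $(d,d)$-resolvable with high probability, that is, with probability at least $1-1/n$.
   Context: Let $M$ be a Boolean matrix with set of columns $C$. For a set $D\subseteq C$ of $d$ columns and a column $j\in C\setminus D$, say that $j$ is distinguishable from $D$ if there is a row $i$ of $M$ with $M[i,j]=1$ and with a $0$ in row $i$ in each of the columns of $D$. The matrix $M$ is $(d,k)$-resolvable if, for every $d$-element subset $D\subseteq C$, there are fewer than $k$ columns in $C\setminus D$ that are not distinguishable from $D$; $(d,d)$-resolvable is the case $k=d$. Sample-injection: given $t$, a multiple of $d$, the random $2t\times n$ matrix $M$ is built column by column: independently for each column, choose $t/d$ of the $2t$ rows uniformly at random, set the entries of the column in these rows to $1$ and all its other entries to $0$. Here $e$ is the base of the natural logarithm. *)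

theory Defs
  imports "HOL-Probability.Product_PMF" "Jordan_Normal_Form.Matrix"
begin

definition distinguishable :: "bool mat \<Rightarrow> nat set \<Rightarrow> nat \<Rightarrow> bool" where
  "distinguishable M D j \<longleftrightarrow> (\<exists>i<dim_row M. M $$ (i, j) \<and> (\<forall>c\<in>D. \<not> M $$ (i, c)))"

definition resolvable :: "bool mat \<Rightarrow> nat \<Rightarrow> nat \<Rightarrow> bool" where
  "resolvable M d k \<longleftrightarrow>
     (\<forall>D \<subseteq> {..<dim_col M}. card D = d \<longrightarrow>
        card {j \<in> {..<dim_col M} - D. \<not> distinguishable M D j} < k)"

(* The rows of a column are drawn without replacement: a uniformly random (t/d)-element
   subset R j of the row indices, independently for each column j < n (Pi_pmf is the product
   distribution; its default value {} is only used for j >= n).  The division is exact when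
   d divides t. *)
definition sample_injection :: "nat \<Rightarrow> nat \<Rightarrow> nat \<Rightarrow> bool mat pmf" where
  "sample_injection n d t =
     map_pmf (\<lambda>R. mat (2 * t) n (\<lambda>(i, j). i \<in> R j))
       (Pi_pmf {..<n} {} (\<lambda>_. pmf_of_set {S. S \<subseteq> {..<2 * t} \<and> card S = t div d}))"

end

theory Submission
  imports Defs
begin

text \<open>
  Union bound over pairs of disjoint \<open>d\<close>-sets of columns \<open>D\<close>, \<open>J\<close> such that no column of
  \<open>J\<close> is distinguishable from \<open>D\<close>.  The columns of \<open>D\<close> jointly have ones in at most \<open>t\<close> of
  the \<open>2 t\<close> rows; conditionally on them, a column of \<open>J\<close> stays inside these rows with
  probability at most \<open>2 powr (- t / d)\<close>, independently of the others.  So each pair occurs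
  with probability at most \<open>2 powr (- t)\<close>, and there are at most
  \<open>(n choose d)\<^sup>2 \<le> (e n / d) ^ (2 d)\<close> pairs.
\<close>

text \<open>Going from \<open>s\<close> to \<open>Suc s\<close> multiplies \<open>m choose s\<close>
  by \<open>(m - s) / Suc s\<close>. Since \<open>2 * (t - s) \<le> 2 * t - s\<close>, also under
  truncated subtraction, the extra factor 2 on the left is absorbed at each step of the
  induction.\<close>

lemma binomial_times_power2_le: "(t choose s) * 2 ^ s \<le> (2 * t) choose s"
proof (induction s)
  case (Suc s)
  have step: "Suc s * (m choose Suc s) = (m - s) * (m choose s)" for m :: nat
    by (cases m) (simp_all only: Suc_times_binomial binomial_absorb_comp diff_Suc_1, auto)
  have "Suc s * ((t choose Suc s) * 2 ^ Suc s) = 2 * (t - s) * ((t choose s) * 2 ^ s)"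
    using arg_cong[OF step[of t], of "\<lambda>x. x * 2 ^ Suc s"] by (simp only: power_Suc ac_simps)
  also have "\<dots> \<le> (2 * t - s) * ((2 * t) choose s)"
    by (intro mult_mono Suc.IH) auto
  also have "\<dots> = Suc s * ((2 * t) choose Suc s)"
    using step[of "2 * t"] by simp
  finally show ?case
    by (simp del: mult_Suc)
qed simp

text \<open>The left side is one term of the exponential series, whose terms are all
  nonnegative.\<close>

lemma power_div_fact_le_exp:
  fixes x :: real
  assumes "x \<ge> 0"
  shows "x ^ k / fact k \<le> exp x"
proof -
  have "(\<Sum>n\<in>{k}. x ^ n / fact n) \<le> (\<Sum>n. x ^ n / fact n)"
    using assms summable_exp[of x]
    by (intro sum_le_suminf) (auto simp: field_simps)
  also have "\<dots> = exp x"
    unfolding exp_def by (simp add: divide_inverse mult.commute)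
  finally show ?thesis by simp
qed

text \<open>Combines \<open>d ^ d / fact d \<le> exp d\<close>, the previous bound at
  \<open>x = k = d\<close>, with \<open>(n choose d) * fact d \<le> n ^ d\<close>.\<close>

lemma binomial_le_exp_power:
  assumes "d > 0"
  shows "real (n choose d) \<le> (exp 1 * real n / real d) ^ d"
proof -
  have "real d ^ d \<le> fact d * exp 1 ^ d"
    using power_div_fact_le_exp[of "real d" d]
    by (simp add: field_simps flip: exp_of_nat_mult)
  then have "real d ^ d * real (n choose d) \<le> (fact d * exp 1 ^ d) * real (n choose d)"
    by (rule mult_right_mono) simp
  also have "\<dots> = exp 1 ^ d * real ((n choose d) * fact d)"
    by simp
  also have "\<dots> \<le> exp 1 ^ d * real (n ^ d)"
    using binomial_fact_pow[of n d] by (intro mult_left_mono) (simp_all only: of_nat_le_iff, simp)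
  finally show ?thesis
    using assms by (simp add: power_divide power_mult_distrib field_simps)
qed

text \<open>The bound on \<open>s\<close> makes the family nonempty, so that
  \<open>pmf_of_set\<close> really is the uniform distribution on it.\<close>

lemma set_pmf_random_subset:
  fixes s m :: nat
  assumes "s \<le> m"
  shows "set_pmf (pmf_of_set {S. S \<subseteq> {..<m} \<and> card S = s}) = {S. S \<subseteq> {..<m} \<and> card S = s}"
  using assms obtain_subset_with_card_n[of s "{..<m}"] by (intro set_pmf_of_set) auto

text \<open>The probability is the quotient of \<open>card U choose s\<close> by
  \<open>(2 * t) choose s\<close>; the numerator is at most \<open>t choose s\<close>.\<close>

lemma prob_random_subset_le:
  fixes s t :: nat
  assumes "s \<le> 2 * t" "card U \<le> t" "U \<subseteq> {..<2 * t}"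
  shows "measure_pmf.prob (pmf_of_set {S. S \<subseteq> {..<2 * t} \<and> card S = s}) {S. S \<subseteq> U} \<le> 1 / 2 ^ s"
proof -
  let ?A = "{S. S \<subseteq> {..<2 * t} \<and> card S = s}"
  have cA: "card ?A = (2 * t) choose s"
    by (simp add: n_subsets)
  have pos: "(2 * t) choose s > 0"
    using assms(1) by simp
  have "?A \<noteq> {}" "finite ?A"
    using cA pos by (metis card.empty less_irrefl, simp)
  then have "measure_pmf.prob (pmf_of_set ?A) {S. S \<subseteq> U} =
      card (?A \<inter> {S. S \<subseteq> U}) / card ?A"
    by (rule measure_pmf_of_set)
  also have "?A \<inter> {S. S \<subseteq> U} = {S. S \<subseteq> U \<and> card S = s}"
    using assms(3) by auto
  also have "card \<dots> = card U choose s"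
    using assms(3) finite_subset by (intro n_subsets) blast
  also have "real (card U choose s) / card ?A \<le> 1 / 2 ^ s"
  proof -
    have "(card U choose s) * 2 ^ s \<le> (t choose s) * 2 ^ s"
      using assms(2) by (intro mult_right_mono binomial_right_mono) auto
    also have "\<dots> \<le> (2 * t) choose s"
      by (rule binomial_times_power2_le)
    finally have "real ((card U choose s) * 2 ^ s) \<le> real ((2 * t) choose s)"
      by (simp only: of_nat_le_iff)
    then show ?thesis
      unfolding cA using pos by (simp add: field_simps)
  qed
  finally show ?thesis .
qed

text \<open>Conditioning on the first component: the probability of \<open>X\<close> is the average
  of the probabilities of its slices, each at most \<open>c\<close>.\<close>

lemma measure_pair_pmf_le:
  assumes "\<And>x. x \<in> set_pmf p \<Longrightarrow> measure_pmf.prob q {y. (x, y) \<in> X} \<le> c" "c \<ge> 0"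
  shows "measure_pmf.prob (pair_pmf p q) X \<le> c"
proof -
  have "pair_pmf p q = bind_pmf p (\<lambda>x. map_pmf (Pair x) q)"
    by (simp add: pair_pmf_def map_pmf_def)
  then have "emeasure (pair_pmf p q) X = (\<integral>\<^sup>+x. emeasure q {y. (x, y) \<in> X} \<partial>p)"
    by (simp add: vimage_def)
  also have "\<dots> \<le> (\<integral>\<^sup>+x. ennreal c \<partial>p)"
    using assms
    by (intro nn_integral_mono_AE AE_pmfI) (simp add: measure_pmf.emeasure_eq_measure)
  also have "\<dots> = ennreal c"
    by simp
  finally show ?thesis
    using assms(2) by (simp add: measure_pmf.emeasure_eq_measure)
qed

lemma prob_covered_columns_le:
  fixes n s t :: nat
  defines "p \<equiv> pmf_of_set {S. S \<subseteq> {..<2 * t} \<and> card S = s}"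
  assumes D: "D \<subseteq> {..<n}" and J: "J \<subseteq> {..<n}" and disj: "D \<inter> J = {}"
    and card: "card D * s \<le> t" and s: "s \<le> 2 * t"
  shows "measure_pmf.prob (Pi_pmf {..<n} {} (\<lambda>_. p)) {R. \<forall>j\<in>J. R j \<subseteq> (\<Union>c\<in>D. R c)}
    \<le> (1 / 2 ^ s) ^ card J"
proof -
  let ?E = "{R. \<forall>j\<in>J. R j \<subseteq> (\<Union>c\<in>D. R c)}"
  let ?B = "{..<n} - D"
  let ?h = "\<lambda>(f, g) x. if x \<in> D then f x else g x"
  have fin: "finite D"
    using D finite_subset by blast
  have set_p: "set_pmf p = {S. S \<subseteq> {..<2 * t} \<and> card S = s}"
    unfolding p_def using s by (rule set_pmf_random_subset)
  \<comment> \<open>The columns in \<open>D\<close> and the remaining ones become two independent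
    components, which \<open>?h\<close> glues together again.\<close>
  have "Pi_pmf {..<n} {} (\<lambda>_. p) = Pi_pmf (D \<union> ?B) {} (\<lambda>_. p)"
    using D by (simp add: Un_absorb1)
  also have "\<dots> = map_pmf ?h (pair_pmf (Pi_pmf D {} (\<lambda>_. p)) (Pi_pmf ?B {} (\<lambda>_. p)))"
    using fin by (intro Pi_pmf_union) auto
  finally have "measure_pmf.prob (Pi_pmf {..<n} {} (\<lambda>_. p)) ?E =
    measure_pmf.prob (pair_pmf (Pi_pmf D {} (\<lambda>_. p)) (Pi_pmf ?B {} (\<lambda>_. p))) (?h -` ?E)"
    by simp
  also have "\<dots> \<le> (1 / 2 ^ s) ^ card J"
  proof (rule measure_pair_pmf_le)
    fix f assume "f \<in> set_pmf (Pi_pmf D {} (\<lambda>_. p))"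
    then have f: "f c \<subseteq> {..<2 * t}" "card (f c) = s" if "c \<in> D" for c
      using that fin by (auto simp: set_Pi_pmf set_p PiE_dflt_def)
    let ?U = "\<Union>c\<in>D. f c"
    have "card ?U \<le> (\<Sum>c\<in>D. card (f c))"
      using fin by (rule card_UN_le)
    then have U: "card ?U \<le> t" "?U \<subseteq> {..<2 * t}"
      using f card by auto
    \<comment> \<open>Once the columns \<open>f\<close> of \<open>D\<close> are fixed, so is their
      union \<open>?U\<close>, and the event constrains each column of \<open>J\<close> separately.
      This makes it a product set; columns outside \<open>J\<close> are unconstrained and contribute
      the factor 1.\<close>
    have "{g. (f, g) \<in> ?h -` ?E} = Pi ?B (\<lambda>x. if x \<in> J then {S. S \<subseteq> ?U} else UNIV)"
    proof (rule Set.set_eqI)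
      fix g
      have "g \<in> {g. (f, g) \<in> ?h -` ?E} \<longleftrightarrow> (\<forall>j\<in>J. ?h (f, g) j \<subseteq> (\<Union>c\<in>D. ?h (f, g) c))"
        by simp
      also have "\<dots> \<longleftrightarrow> (\<forall>j\<in>J. g j \<subseteq> ?U)"
        using disj by (intro ball_cong arg_cong2[of _ _ _ _ "(\<subseteq>)"]) auto
      also have "\<dots> \<longleftrightarrow> g \<in> Pi ?B (\<lambda>x. if x \<in> J then {S. S \<subseteq> ?U} else UNIV)"
        using J disj by (auto simp: Pi_iff)
      finally show "g \<in> {g. (f, g) \<in> ?h -` ?E} \<longleftrightarrow>
          g \<in> Pi ?B (\<lambda>x. if x \<in> J then {S. S \<subseteq> ?U} else UNIV)" .
    qed
    then have "measure_pmf.prob (Pi_pmf ?B {} (\<lambda>_. p)) {g. (f, g) \<in> ?h -` ?E}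
        = (\<Prod>x\<in>?B. measure_pmf.prob p (if x \<in> J then {S. S \<subseteq> ?U} else UNIV))"
      by (simp add: measure_Pi_pmf_Pi)
    also have "\<dots> = (\<Prod>x\<in>J. measure_pmf.prob p {S. S \<subseteq> ?U})"
      using J disj by (intro prod.mono_neutral_cong_right) auto
    also have "\<dots> \<le> (\<Prod>x\<in>J. 1 / 2 ^ s)"
      unfolding p_def using prob_random_subset_le[OF s U] by (intro prod_mono) auto
    finally show "measure_pmf.prob (Pi_pmf ?B {} (\<lambda>_. p)) {g. (f, g) \<in> ?h -` ?E}
        \<le> (1 / 2 ^ s) ^ card J"
      by simp
  qed simp
  finally show ?thesis .
qed

text \<open>A violating \<open>D\<close> has at least \<open>k\<close> indistinguishable columns;
  keeping exactly \<open>k\<close> of them leaves only sets of a fixed size for the union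
  bound.\<close>

lemma not_resolvableE:
  assumes "\<not> resolvable M d k"
  obtains D J where "D \<subseteq> {..<dim_col M}" "card D = d" "J \<subseteq> {..<dim_col M}" "card J = k" "D \<inter> J = {}"
    "\<And>j. j \<in> J \<Longrightarrow> \<not> distinguishable M D j"
proof -
  obtain D where D: "D \<subseteq> {..<dim_col M}" "card D = d"
    and "k \<le> card {j \<in> {..<dim_col M} - D. \<not> distinguishable M D j}"
    using assms by (auto simp: resolvable_def not_less)
  then obtain J where J: "J \<subseteq> {j \<in> {..<dim_col M} - D. \<not> distinguishable M D j}" "card J = k"
    by (meson obtain_subset_with_card_n)
  show ?thesis
    by (rule that[of D J]) (use D J in auto)
qed

text \<open>An element of \<open>R j\<close> lying in no \<open>R c\<close> with
  \<open>c \<in> D\<close> would be a distinguishing row, as it is below \<open>m\<close> and hence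
  a row of the matrix.\<close>

lemma not_distinguishable_mat:
  assumes "R j \<subseteq> {..<m}" "j < n" "D \<subseteq> {..<n}"
    and "\<not> distinguishable (mat m n (\<lambda>(i, j). i \<in> R j)) D j"
  shows "R j \<subseteq> (\<Union>c\<in>D. R c)"
proof
  fix i assume i: "i \<in> R j"
  then have im: "i < m" using assms(1) by auto
  have entry: "mat m n (\<lambda>(i, j). i \<in> R j) $$ (i, c) \<longleftrightarrow> i \<in> R c" if "c < n" for c
    using im that by simp
  obtain c where "c \<in> D" "mat m n (\<lambda>(i, j). i \<in> R j) $$ (i, c)"
    using assms(4) im i entry[OF assms(2)] unfolding distinguishable_def dim_row_mat by blast
  then show "i \<in> (\<Union>c\<in>D. R c)"
    using entry assms(3) by blast
qed

theorem corollary2: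
  fixes n d t :: nat
  assumes "n > 0" and "d > 0" and "t > 0" and "d < n" and "d dvd t"
    and "real t \<ge> 2 * real d * log 2 (exp 1 * real n / real d) + log 2 (real n)"
  shows "measure_pmf.prob (sample_injection n d t) {M. resolvable M d d} \<ge> 1 - 1 / real n"
proof -
  define s where "s = t div d"
  define p where "p = pmf_of_set {S. S \<subseteq> {..<2 * t} \<and> card S = s}"
  define P where "P = Pi_pmf {..<n} {} (\<lambda>_. p)"
  define X where "X = {D. D \<subseteq> {..<n} \<and> card D = d}"
  define Pairs where "Pairs = {(D, J) \<in> X \<times> X. D \<inter> J = {}}"
  define E where "E = (\<lambda>(D, J). {R :: nat \<Rightarrow> nat set. \<forall>j\<in>J. R j \<subseteq> (\<Union>c\<in>D. R c)})"
  let ?mat = "\<lambda>R. mat (2 * t) n (\<lambda>(i, j). i \<in> R j)"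
  define q where "q = exp 1 * real n / real d"
  have ds: "d * s = t"
    using assms(5) by (simp add: s_def)
  have s: "s \<le> 2 * t"
    using div_le_dividend[of t d] unfolding s_def by linarith
  have q: "q > 0"
    using assms by (simp add: q_def)
  have [simp]: "finite X"
    by (simp add: X_def)
  have sub: "Pairs \<subseteq> X \<times> X"
    by (auto simp: Pairs_def)
  then have fin: "finite Pairs"
    by (rule finite_subset) simp
  \<comment> \<open>Dropping disjointness leaves two free choices of a \<open>d\<close>-set.\<close>
  have "card Pairs \<le> card (X \<times> X)"
    using sub by (intro card_mono) simp_all
  then have "real (card Pairs) \<le> real (n choose d) * real (n choose d)"
    by (simp add: X_def n_subsets card_cartesian_product flip: of_nat_mult)
  also have "\<dots> \<le> q ^ d * q ^ d"
    using binomial_le_exp_power[OF assms(2), of n] q by (intro mult_mono) (auto simp: q_def)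
  finally have card_Pairs: "real (card Pairs) \<le> q ^ (2 * d)"
    by (simp add: mult_2 power_add)

  have set_p: "set_pmf p = {S. S \<subseteq> {..<2 * t} \<and> card S = s}"
    unfolding p_def using s by (rule set_pmf_random_subset)
  have "measure_pmf.prob P {R. \<not> resolvable (?mat R) d d} \<le> measure_pmf.prob P (\<Union>x\<in>Pairs. E x)"
  \<comment> \<open>The inclusion is shown on the support of \<open>P\<close> only, where every
    column's set consists of actual row indices.\<close>
  proof (rule measure_pmf.finite_measure_mono_AE)
    show "AE R in P. R \<in> {R. \<not> resolvable (?mat R) d d} \<longrightarrow> R \<in> (\<Union>x\<in>Pairs. E x)"
    proof (intro AE_pmfI impI)
      fix R assume "R \<in> set_pmf P" and "R \<in> {R. \<not> resolvable (?mat R) d d}"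
      then have R: "R j \<subseteq> {..<2 * t}" if "j < n" for j
        using that by (auto simp: P_def set_Pi_pmf set_p PiE_dflt_def)
      from \<open>R \<in> {R. \<not> resolvable (?mat R) d d}\<close>
      have "\<not> resolvable (?mat R) d d"
        by (rule CollectD)
      then obtain D J where *: "D \<subseteq> {..<dim_col (?mat R)}" "card D = d"
        "J \<subseteq> {..<dim_col (?mat R)}" "card J = d" "D \<inter> J = {}"
        and indist: "\<And>j. j \<in> J \<Longrightarrow> \<not> distinguishable (?mat R) D j"
        by (rule not_resolvableE) blast
      note * = *[unfolded dim_col_mat]
      have "R j \<subseteq> (\<Union>c\<in>D. R c)" if "j \<in> J" for j
        using * that by (intro not_distinguishable_mat[OF R _ _ indist]) auto
      then have "R \<in> E (D, J)"
        by (simp add: E_def)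
      moreover have "(D, J) \<in> Pairs"
        using * by (auto simp: Pairs_def X_def)
      ultimately show "R \<in> (\<Union>x\<in>Pairs. E x)"
        by blast
    qed
  qed simp
  also have "\<dots> \<le> (\<Sum>x\<in>Pairs. measure_pmf.prob P (E x))"
    using fin by (intro measure_pmf.finite_measure_subadditive_finite) auto
  also have "\<dots> \<le> (\<Sum>x\<in>Pairs. 1 / 2 ^ t)"
  proof (rule sum_mono)
    fix x assume "x \<in> Pairs"
    then obtain D J where x: "x = (D, J)" and DJ: "D \<subseteq> {..<n}" "J \<subseteq> {..<n}" "D \<inter> J = {}"
      and card: "card D = d" "card J = d"
      by (auto simp: Pairs_def X_def)
    have "card D * s \<le> t"
      using card ds by simp
    \<comment> \<open>With \<open>card J = d\<close> the bound is \<open>(1 / 2 ^ s) ^ d\<close>,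
      which equals \<open>1 / 2 ^ t\<close> because \<open>d * s = t\<close>.\<close>
    from prob_covered_columns_le[OF DJ this s]
    show "measure_pmf.prob P (E x) \<le> 1 / 2 ^ t"
      by (simp add: x E_def P_def p_def card power_one_over mult.commute flip: power_mult ds)
  qed
  also have "\<dots> \<le> q ^ (2 * d) / 2 ^ t"
    using card_Pairs by (simp add: divide_right_mono)
  also have "\<dots> \<le> 1 / real n"
  proof -
    \<comment> \<open>Exponentiating the hypothesis on \<open>t\<close> to base 2 gives
      \<open>q ^ (2 * d) * n \<le> 2 ^ t\<close>; the summand \<open>log 2 n\<close> supplies the
      factor \<open>n\<close>.\<close>
    have "2 powr (2 * real d * log 2 q + log 2 (real n)) = (2 powr log 2 q) powr real (2 * d) * real n"
      using assms(1) by (simp add: powr_add powr_powr mult.commute)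
    also have "\<dots> = q ^ (2 * d) * real n"
      using q by (simp only: powr_log_cancel powr_realpow)
    finally have "q ^ (2 * d) * real n = 2 powr (2 * real d * log 2 q + log 2 (real n))"
      by simp
    also have "\<dots> \<le> 2 powr real t"
      using assms(6) by (simp add: q_def)
    finally show ?thesis
      using assms(1) by (simp add: powr_realpow field_simps)
  qed
  finally have "measure_pmf.prob P {R. \<not> resolvable (?mat R) d d} \<le> 1 / real n" .
  moreover have "measure_pmf.prob P {R. resolvable (?mat R) d d} =
      1 - measure_pmf.prob P {R. \<not> resolvable (?mat R) d d}"
    using measure_pmf.prob_compl[of "{R. \<not> resolvable (?mat R) d d}" P]
    by (simp add: Compl_eq_Diff_UNIV[symmetric] Collect_neg_eq)
  moreover have "measure_pmf.prob (sample_injection n d t) {M. resolvable M d d} =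
      measure_pmf.prob P {R. resolvable (?mat R) d d}"
    by (simp add: sample_injection_def P_def p_def s_def vimage_def)
  ultimately show ?thesis
    by simp
qed

end
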